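(* Let $a>0$, $\beta>0$, and let $f,g:[a,b]\to\mathbb{R}$ be functions such that: (1) $f,g$ are continuous on $[a,b]$; (2) $f,g$ are $\alpha$-differentiable on $(a,b)$ for some $\alpha\in(0,1)$. Then there exists $c\in(a,b)$ such that $$\frac{\mathscr{D}_M^{\alpha,\beta}f(c)}{\mathscr{D}_M^{\alpha,\beta}g(c)}=\frac{f(b)-f(a)}{g(b)-g(a)}.$$
   Context: For $\beta>0$, $\mathbb{E}_\beta(x)=\sum_{k=0}^\infty \frac{x^k}{\Gamma(\beta k+1)}$ is the one-parameter Mittag-Leffler function. For $0<\alpha<1$, $\beta>0$ and $t>0$, the local $M$-derivative of order $\alpha$ of a real-valued function $f$ at $t$ is $$\mathscr{D}_M^{\alpha,\beta}f(t)=\lim_{\varepsilon\to 0}\frac{f\big(t\,\mathbb{E}_\beta(\varepsilon t^{-\alpha})\big)-f(t)}{\varepsilon}.$$ $f$ is called $\alpha$-differentiable at $t$ (in the sense of the local $M$-derivative) if this limit exists.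
   Formalization: The quotient identity fails in general (denominators may vanish). Proved instead: the identity with denominators cleared, for some c in (a,b); and if the M-derivative of g has no zero on (a,b), then g(b)≠g(a) and the quotient identity holds at that c. *)

theory Defs
  imports "HOL-Analysis.Analysis"
begin

definition mittag_leffler :: "real \<Rightarrow> real \<Rightarrow> real" where
  "mittag_leffler \<beta> x = (\<Sum>k. x ^ k / Gamma (\<beta> * real k + 1))"

text \<open>
  The definitions below are meant for \<open>0 < \<alpha> < 1\<close>, \<open>\<beta> > 0\<close> and \<open>t > 0\<close>. The limit is
  two-sided and depends only on the values of \<open>f\<close> near \<open>t\<close>.
\<close>

definition M_quotient :: "real \<Rightarrow> real \<Rightarrow> (real \<Rightarrow> real) \<Rightarrow> real \<Rightarrow> real \<Rightarrow> real" where
  "M_quotient \<alpha> \<beta> f t \<epsilon> =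
     (f (t * mittag_leffler \<beta> (\<epsilon> * t powr (- \<alpha>))) - f t) / \<epsilon>"

definition M_differentiable :: "real \<Rightarrow> real \<Rightarrow> (real \<Rightarrow> real) \<Rightarrow> real \<Rightarrow> bool" where
  "M_differentiable \<alpha> \<beta> f t \<longleftrightarrow> (\<exists>D. (M_quotient \<alpha> \<beta> f t \<longlongrightarrow> D) (at 0))"

text \<open>Unspecified (by \<^const>\<open>Lim\<close>) where the function is not differentiable in this sense.\<close>

definition M_deriv :: "real \<Rightarrow> real \<Rightarrow> (real \<Rightarrow> real) \<Rightarrow> real \<Rightarrow> real" where
  "M_deriv \<alpha> \<beta> f t = Lim (at 0) (M_quotient \<alpha> \<beta> f t)"

end

theory Submission
  imports Defs
begin

text \<open>
  Rolle's argument works without relating \<open>M\<close>-derivatives to ordinary ones. Since \<^term>\<open>mittag_leffler \<beta>\<close> is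
  continuous at \<^term>\<open>0::real\<close> with value \<^term>\<open>1::real\<close>, the points
  \<open>t E\<^sub>\<beta>(\<epsilon> t\<^sup>-\<^sup>\<alpha>)\<close> tend to \<open>t\<close> as \<open>\<epsilon>\<close> tends to zero. At an interior extremum the numerator of the
  quotient therefore has a constant sign while \<open>\<epsilon>\<close> changes sign, so the limit vanishes. Apply
  this to the usual combination \<open>(g b - g a) f - (f b - f a) g\<close>.
\<close>

text \<open>On the compact interval from 1 to 2 a positive minimum is attained, and beyond 2 Gamma
  increases. The bound controls all coefficients of the Mittag-Leffler series at once.\<close>

lemma Gamma_real_bounded_below:
  obtains m :: real where "m > 0" "\<And>x. x \<ge> 1 \<Longrightarrow> m \<le> Gamma x"
proof -
  have "continuous_on {1..2::real} Gamma"
    by (intro continuous_on_Gamma continuous_on_id) (auto elim!: nonpos_Ints_cases)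
  then obtain x0 :: real where x0: "x0 \<in> {1..2}" "\<And>x. x \<in> {1..2} \<Longrightarrow> Gamma x0 \<le> Gamma x"
    using continuous_attains_inf[of "{1..2::real}" Gamma] by auto
  have "Gamma x0 \<le> Gamma x" if "1 \<le> x" for x
  proof (cases "x \<le> 2")
    case False
    then have "Gamma 2 < Gamma x"
      by (intro Gamma_real_strict_mono) auto
    with x0(2)[of 2] show ?thesis by simp
  qed (use that x0(2) in simp)
  moreover have "Gamma x0 > 0"
    using x0 by (intro Gamma_real_pos) auto
  ultimately show thesis
    using that by blast
qed

lemma mittag_leffler_0: "mittag_leffler \<beta> 0 = 1"
  using powser_zero[of "\<lambda>k. 1 / Gamma (\<beta> * real k + 1)"]
  by (simp add: mittag_leffler_def)

lemma isCont_mittag_leffler_0: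
  assumes "0 < \<beta>"
  shows "isCont (mittag_leffler \<beta>) 0"
proof -
  obtain m :: real where m: "m > 0" "\<And>x. x \<ge> 1 \<Longrightarrow> m \<le> Gamma x"
    by (rule Gamma_real_bounded_below) blast
  \<comment> \<open>Convergence at the single point 1/2, by comparison with a geometric series,
    makes the power series continuous at every x with |x| < 1/2, in particular at 0.\<close>
  have bound: "norm (1 / Gamma (\<beta> * real k + 1) * (1 / 2) ^ k) \<le> 1 / m * (1 / 2) ^ k" for k
  proof -
    have "m \<le> Gamma (\<beta> * real k + 1)"
      using assms by (intro m) simp
    then show ?thesis
      using m(1) by (simp add: field_simps)
  qed
  have "summable (\<lambda>k. 1 / m * (1 / 2) ^ k)"
    by (intro summable_mult summable_geometric) simp
  then have "summable (\<lambda>k. 1 / Gamma (\<beta> * real k + 1) * (1 / 2) ^ k)"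
    by (rule summable_comparison_test') (rule bound)
  then have "isCont (\<lambda>x. \<Sum>k. 1 / Gamma (\<beta> * real k + 1) * x ^ k) 0"
    by (rule isCont_powser) simp
  then show ?thesis
    by (simp add: mittag_leffler_def[abs_def])
qed

lemma tendsto_mittag_leffler_shift:
  assumes "0 < \<beta>"
  shows "((\<lambda>\<epsilon>. t * mittag_leffler \<beta> (\<epsilon> * t powr (- \<alpha>))) \<longlongrightarrow> t) (at 0)"
proof -
  have "((\<lambda>\<epsilon>. \<epsilon> * t powr (- \<alpha>)) \<longlongrightarrow> 0) (at 0)"
    by (intro tendsto_eq_intros | simp)+
  from isCont_tendsto_compose[OF isCont_mittag_leffler_0[OF assms] this]
  have "((\<lambda>\<epsilon>. mittag_leffler \<beta> (\<epsilon> * t powr (- \<alpha>))) \<longlongrightarrow> 1) (at 0)"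
    by (simp add: mittag_leffler_0)
  from tendsto_mult_left[OF this, of t] show ?thesis
    by simp
qed

text \<open>\<open>Lim\<close> picks a limit by description; limits along the nontrivial filter
  \<open>at 0\<close> are unique, so it picks the one that exists.\<close>

lemma M_quotient_tendsto_M_deriv:
  assumes "M_differentiable \<alpha> \<beta> f t"
  shows "(M_quotient \<alpha> \<beta> f t \<longlongrightarrow> M_deriv \<alpha> \<beta> f t) (at 0)"
proof -
  from assms obtain D where "(M_quotient \<alpha> \<beta> f t \<longlongrightarrow> D) (at 0)"
    unfolding M_differentiable_def by blast
  moreover from this have "M_deriv \<alpha> \<beta> f t = D"
    unfolding M_deriv_def by (intro tendsto_Lim) auto
  ultimately show ?thesis by simp
qed

lemma M_quotient_limit_at_max:
  assumes "0 < \<beta>" "open S" "c \<in> S"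
    and max: "\<And>x. x \<in> S \<Longrightarrow> F x \<le> F c"
    and lim: "(M_quotient \<alpha> \<beta> F c \<longlongrightarrow> D) (at 0)"
  shows "D = 0"
proof -
  \<comment> \<open>The shifted points tend to c, so they eventually enter the open set S, where c
    is a maximum.\<close>
  have ev: "\<forall>\<^sub>F \<epsilon> in at 0. F (c * mittag_leffler \<beta> (\<epsilon> * c powr (- \<alpha>))) \<le> F c"
    using topological_tendstoD[OF tendsto_mittag_leffler_shift[OF assms(1)] assms(2,3)]
    by (rule eventually_mono) (rule max)
  have right: "(M_quotient \<alpha> \<beta> F c \<longlongrightarrow> D) (at_right 0)"
    and left: "(M_quotient \<alpha> \<beta> F c \<longlongrightarrow> D) (at_left 0)"
    using lim by (simp_all add: filterlim_at_split)
  have "\<forall>\<^sub>F \<epsilon> in at_right 0. M_quotient \<alpha> \<beta> F c \<epsilon> \<le> 0"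
    using ev[unfolded eventually_at_split, THEN conjunct2] eventually_at_right_less[of "0::real"]
    by eventually_elim (auto simp: M_quotient_def divide_le_0_iff)
  then have "D \<le> 0"
    using tendsto_upperbound[OF right] by simp
  have "\<forall>\<^sub>F \<epsilon> in at_left (0::real). \<epsilon> < 0"
    by (simp add: eventually_at_filter)
  with ev[unfolded eventually_at_split, THEN conjunct1]
  have "\<forall>\<^sub>F \<epsilon> in at_left 0. 0 \<le> M_quotient \<alpha> \<beta> F c \<epsilon>"
    by eventually_elim (auto simp: M_quotient_def zero_le_divide_iff)
  then have "0 \<le> D"
    using tendsto_lowerbound[OF left] by simp
  with \<open>D \<le> 0\<close> show ?thesis by simp
qed

text \<open>An equality of functions, which can be rewritten inside a limit. It also covers
  \<epsilon> = 0, where division by zero makes both sides 0.\<close>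

lemma M_quotient_lincomb:
  "M_quotient \<alpha> \<beta> (\<lambda>x. p * f x + q * g x) t =
     (\<lambda>\<epsilon>. p * M_quotient \<alpha> \<beta> f t \<epsilon> + q * M_quotient \<alpha> \<beta> g t \<epsilon>)"
  by (rule ext) (simp add: M_quotient_def diff_divide_distrib add_divide_distrib algebra_simps)

text \<open>The limits are given as a family D instead of \<open>M_deriv\<close>, so that a linear
  combination can be treated without computing its own \<open>M_deriv\<close>.\<close>

lemma M_Rolle:
  fixes F :: "real \<Rightarrow> real"
  assumes "0 < \<beta>" "a < b" and cont: "continuous_on {a..b} F" and eq: "F a = F b"
    and lim: "\<And>t. t \<in> {a<..<b} \<Longrightarrow> (M_quotient \<alpha> \<beta> F t \<longlongrightarrow> D t) (at 0)"
  shows "\<exists>c\<in>{a<..<b}. D c = 0"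
proof -
  obtain u where u: "u \<in> {a..b}" "\<And>x. x \<in> {a..b} \<Longrightarrow> F x \<le> F u"
    using continuous_attains_sup[OF _ _ cont] \<open>a < b\<close> by auto
  obtain v where v: "v \<in> {a..b}" "\<And>x. x \<in> {a..b} \<Longrightarrow> F v \<le> F x"
    using continuous_attains_inf[OF _ _ cont] \<open>a < b\<close> by auto
  have max: "D c = 0" if c: "c \<in> {a<..<b}" "\<And>x. x \<in> {a<..<b} \<Longrightarrow> F x \<le> F c" for c
    using M_quotient_limit_at_max[OF \<open>0 < \<beta>\<close> open_greaterThanLessThan c lim[OF c(1)]] .
  have min: "D c = 0" if c: "c \<in> {a<..<b}" "\<And>x. x \<in> {a<..<b} \<Longrightarrow> F c \<le> F x" for c
  proof -
    \<comment> \<open>A minimum of F is a maximum of -F; the second summand of the combination is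
      switched off by the coefficient 0.\<close>
    have "M_quotient \<alpha> \<beta> (\<lambda>x. - F x) c = (\<lambda>\<epsilon>. - M_quotient \<alpha> \<beta> F c \<epsilon>)"
      using M_quotient_lincomb[of \<alpha> \<beta> "-1" F 0 F c] by simp
    then have "(M_quotient \<alpha> \<beta> (\<lambda>x. - F x) c \<longlongrightarrow> - D c) (at 0)"
      using tendsto_minus[OF lim[OF c(1)]] by simp
    from M_quotient_limit_at_max[OF \<open>0 < \<beta>\<close> open_greaterThanLessThan c(1) _ this]
    show ?thesis using c(2) by simp
  qed
  consider "u \<in> {a<..<b}" | "v \<in> {a<..<b}" | "u \<in> {a, b}" "v \<in> {a, b}"
    using u(1) v(1) by force
  then show ?thesis
  proof cases
    case 1
    then show ?thesis using max[of u] u(2) by auto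
  next
    case 2
    then show ?thesis using min[of v] v(2) by auto
  next
    case 3
    \<comment> \<open>With both extrema at endpoints, F is constant, and the midpoint serves as an
      interior maximum.\<close>
    have mid: "(a + b) / 2 \<in> {a<..<b}"
      using \<open>a < b\<close> by simp
    have "F u = F v"
      using 3 eq by auto
    then have "F x = F u" if "x \<in> {a..b}" for x
      using u(2)[OF that] v(2)[OF that] by simp
    then have "D ((a + b) / 2) = 0"
      using mid by (intro max) auto
    with mid show ?thesis by blast
  qed
qed

text \<open>The product form makes sense even when a denominator vanishes. The quotient form, at the
  same c, is claimed when the M-derivative of g has no zero in the interval.\<close>

theorem theorem8:
  fixes a b \<alpha> \<beta> :: real and f g :: "real \<Rightarrow> real"
  assumes "0 < a" and "a < b" and "0 < \<beta>" and "0 < \<alpha>" and "\<alpha> < 1"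
    and "continuous_on {a..b} f" and "continuous_on {a..b} g"
    and "\<And>t. t \<in> {a<..<b} \<Longrightarrow> M_differentiable \<alpha> \<beta> f t"
    and "\<And>t. t \<in> {a<..<b} \<Longrightarrow> M_differentiable \<alpha> \<beta> g t"
  shows "\<exists>c\<in>{a<..<b}.
           M_deriv \<alpha> \<beta> f c * (g b - g a) = M_deriv \<alpha> \<beta> g c * (f b - f a) \<and>
           ((\<forall>t\<in>{a<..<b}. M_deriv \<alpha> \<beta> g t \<noteq> 0) \<longrightarrow>
              g b - g a \<noteq> 0 \<and>
              M_deriv \<alpha> \<beta> f c / M_deriv \<alpha> \<beta> g c = (f b - f a) / (g b - g a))"
proof -
  define p q where "p = g b - g a" and "q = - (f b - f a)"
  have "\<exists>c\<in>{a<..<b}. p * M_deriv \<alpha> \<beta> f c + q * M_deriv \<alpha> \<beta> g c = 0"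
  proof (rule M_Rolle[OF \<open>0 < \<beta>\<close> \<open>a < b\<close>])
    show "continuous_on {a..b} (\<lambda>x. p * f x + q * g x)"
      by (intro continuous_intros assms)
    show "p * f a + q * g a = p * f b + q * g b"
      by (simp add: p_def q_def algebra_simps)
    show "(M_quotient \<alpha> \<beta> (\<lambda>x. p * f x + q * g x) t
            \<longlongrightarrow> p * M_deriv \<alpha> \<beta> f t + q * M_deriv \<alpha> \<beta> g t) (at 0)"
      if "t \<in> {a<..<b}" for t
      unfolding M_quotient_lincomb
      by (intro tendsto_intros M_quotient_tendsto_M_deriv assms that)
  qed
  then obtain c where c: "c \<in> {a<..<b}"
    "M_deriv \<alpha> \<beta> f c * (g b - g a) = M_deriv \<alpha> \<beta> g c * (f b - f a)"
    by (auto simp: p_def q_def algebra_simps)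
  \<comment> \<open>Equal endpoint values of g would, by \<open>M_Rolle\<close> applied to g itself,
    produce a zero of its M-derivative.\<close>
  have "g b - g a \<noteq> 0" if nz: "\<forall>t\<in>{a<..<b}. M_deriv \<alpha> \<beta> g t \<noteq> 0"
  proof
    assume "g b - g a = 0"
    then have "\<exists>t\<in>{a<..<b}. M_deriv \<alpha> \<beta> g t = 0"
      using assms by (intro M_Rolle[of \<beta> a b g \<alpha>] M_quotient_tendsto_M_deriv) auto
    with nz show False by blast
  qed
  with c show ?thesis
    by (intro bexI[of _ c]) (auto simp: frac_eq_eq mult.commute)
qed

end
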